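(* For every integer $n \ge 3$, the cycle $C_n$ on $n$ vertices satisfies \[\left\lceil \sqrt{2n+1}-1\right\rceil \le b_{\rm g}(C_n) \le \left\lceil \sqrt{2n+\tfrac14}-\tfrac12\right\rceil\] and \[\left\lceil \sqrt{2n+7}-2\right\rceil \le b_{\rm g}'(C_n) \le \left\lceil \sqrt{2n+\tfrac{17}{4}}-\tfrac32\right\rceil.\]
   Context: The burning game on a finite simple graph $G$ is played by two players, Burner and Staller. Each vertex is either burned or unburned, and once burned it stays burned. In round 1 the starting player chooses one unburned vertex and burns it (selection phase only). Each round $t \ge 2$ consists of a spreading phase, in which every unburned vertex with a burned neighbor becomes burned, followed, if unburned vertices remain, by a selection phase in which the player whose turn it is burns one unburned vertex; the two players make the selections alternately. The game ends in the first round in which all vertices are burned (this may happen right after a spreading phase), and its length is the number of that round. Burner wants to minimize the length and Staller to maximize it. $b_{\rm g}(G)$ is the length under optimal play when Burner makes the first selection, and $b_{\rm g}'(G)$ is the length under optimal play when Staller makes the first selection. *)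

theory Defs
  imports Complex_Main "Graph_Theory.Pair_Digraph"
begin

section \<open>The burning game on a finite simple graph\<close>

text \<open>Finite simple graphs are rendered by the locale \<open>pair_graph\<close>: finite symmetric loop-free
  digraphs without parallel arcs.\<close>

datatype player = Burner | Staller

fun opponent :: "player \<Rightarrow> player" where
  "opponent Burner = Staller"
| "opponent Staller = Burner"

context pair_graph
begin

definition spread :: "'a set \<Rightarrow> 'a set" where
  "spread B = B \<union> {v \<in> pverts G. \<exists>u\<in>B. (u, v) \<in> parcs G}"

lemma subset_spread: "B \<subseteq> spread B"
  by (simp add: spread_def)

text \<open>\<open>rounds_left p B\<close> is the number of rounds still to be played under optimal play when a round
  has just ended with burned set \<open>B\<close> and player \<open>p\<close> is the next one to select. It is computed by
  backward induction, Burner minimizing and Staller maximizing. If the spreading phase burns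
  everything, the game ends in that round without a selection.\<close>

function rounds_left :: "player \<Rightarrow> 'a set \<Rightarrow> nat" where
  "rounds_left p B =
     (if pverts G \<subseteq> B then 0
      else if pverts G \<subseteq> spread B then 1
      else 1 + (case p of
          Burner \<Rightarrow> (MIN v \<in> pverts G - spread B. rounds_left (opponent p) (insert v (spread B)))
        | Staller \<Rightarrow> (MAX v \<in> pverts G - spread B. rounds_left (opponent p) (insert v (spread B)))))"
  by pat_completeness auto
termination
proof (relation "measure (\<lambda>(p, B). card (pverts G - B))", goal_cases)
  case 1
  show ?case by simp
next
  case (2 p B v)
  have "pverts G - insert v (spread B) \<subset> pverts G - B"
    using 2 subset_spread[of B] by auto
  then show ?case
    by (simp add: psubset_card_mono pair_finite_verts)
next
  case (3 p B v)
  have "pverts G - insert v (spread B) \<subset> pverts G - B"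
    using 3 subset_spread[of B] by auto
  then show ?case
    by (simp add: psubset_card_mono pair_finite_verts)
qed

declare rounds_left.simps [simp del]

text \<open>Round 1 consists of a selection only. The graph is assumed to have at least one vertex.\<close>

definition game_burning_number :: nat where
  "game_burning_number = 1 + (MIN v \<in> pverts G. rounds_left Staller {v})"

definition staller_game_burning_number :: nat where
  "staller_game_burning_number = 1 + (MAX v \<in> pverts G. rounds_left Burner {v})"

end

notation pair_graph.game_burning_number (\<open>b\<^sub>g\<close>)
notation pair_graph.staller_game_burning_number (\<open>b\<^sub>g''\<close>)


section \<open>Cycles\<close>

text \<open>A simple graph, namely \<open>C\<^sub>n\<close>, only for \<open>n \<ge> 3\<close>.\<close>

definition cycle_graph :: "nat \<Rightarrow> nat pair_pre_digraph" where
  "cycle_graph n =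
     \<lparr> pverts = {..<n},
       parcs = {(i, j). i < n \<and> j < n \<and> (j = (i + 1) mod n \<or> i = (j + 1) mod n)} \<rparr>"

lemma pair_graph_cycle_graph:
  assumes "n \<ge> 3"
  shows "pair_graph (cycle_graph n)"
proof
  show "finite (parcs (cycle_graph n))"
    by (rule finite_subset[of _ "{..<n} \<times> {..<n}"]) (auto simp: cycle_graph_def)
  show "symmetric (with_proj (cycle_graph n))"
    by (auto simp: symmetric_def sym_def cycle_graph_def)
  show "fst e \<noteq> snd e" if "e \<in> parcs (cycle_graph n)" for e
    using that assms by (auto simp: cycle_graph_def mod_Suc split: if_splits)
qed (auto simp: cycle_graph_def)

end

theory Submission
  imports Defs "HOL-Number_Theory.Cong"
begin

text \<open>Lower bounds: every spreading phase burns at most two vertices per burned segment, and Staller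
  always burns a neighbour of a segment, so that only Burner's selections create new segments.

  Upper bounds: a vertex selected when \<open>r\<close> more rounds follow ends up burning exactly the segment
  of \<open>2r + 1\<close> vertices around it. So let \<open>C\<close> be the set of vertices that will be burned at the end
  of \<open>k\<close> rounds without any further selection; it is not changed by spreading, and a selection adds
  a segment of length \<open>2r + 1\<close>. Burner places this segment directly behind a right end of \<open>C\<close>.
  Either it is disjoint from \<open>C\<close> and nothing is wasted, or it closes a gap. Staller can open a new
  gap, but only by adding a full disjoint segment, which pays for the waste \<open>2r\<close> that Burner may
  incur in closing it later. Hence \<open>2 |V - C| + 4 r (g - 1)\<close>, where \<open>g\<close> is the number of gaps of
  \<open>C\<close>, never increases at Staller's moves and drops by \<open>4 r + 2\<close>, or to
  \<open>0\<close>, at Burner's moves.\<close>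

section \<open>Spreading and the game recursion on an arbitrary finite graph\<close>

context pair_graph
begin

lemma spread_Un: "spread (A \<union> B) = spread A \<union> spread B"
  by (auto simp: spread_def)

lemma funpow_spread_Un: "(spread ^^ k) (A \<union> B) = (spread ^^ k) A \<union> (spread ^^ k) B"
  by (induction k) (simp_all add: spread_Un)

lemma spread_subset_verts: "B \<subseteq> pverts G \<Longrightarrow> spread B \<subseteq> pverts G"
  by (auto simp: spread_def)

lemma funpow_spread_subset_verts: "B \<subseteq> pverts G \<Longrightarrow> (spread ^^ k) B \<subseteq> pverts G"
  by (induction k) (simp_all add: spread_subset_verts)

lemma subset_funpow_spread: "B \<subseteq> (spread ^^ k) B"
  by (induction k) (use subset_spread in auto)

lemma rounds_left_eq_0_iff: "rounds_left p B = 0 \<longleftrightarrow> pverts G \<subseteq> B"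
  by (subst rounds_left.simps) auto

text \<open>The inductions work with thresholds rather than exact values. A full spread leaves
  Burner nothing to select, hence the separate disjunct; in the version for Staller this situation
  makes the universal quantifier vacuous.\<close>

lemma rounds_left_Burner_le_Suc_iff:
  "rounds_left Burner B \<le> Suc k \<longleftrightarrow> pverts G \<subseteq> spread B \<or>
     (\<exists>v\<in>pverts G - spread B. rounds_left Staller (insert v (spread B)) \<le> k)"
proof (cases "pverts G \<subseteq> spread B")
  case False
  then have ne: "pverts G - spread B \<noteq> {}" by blast
  from False have "\<not> pverts G \<subseteq> B" using subset_spread by blast
  then show ?thesis
    using False ne by (subst rounds_left.simps) (simp add: Min_le_iff)
qed (subst rounds_left.simps, simp)

lemma rounds_left_Staller_le_Suc_iff:
  "rounds_left Staller B \<le> Suc k \<longleftrightarrow>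
     (\<forall>v\<in>pverts G - spread B. rounds_left Burner (insert v (spread B)) \<le> k)"
proof (cases "pverts G \<subseteq> spread B")
  case True
  then show ?thesis by (subst rounds_left.simps) auto
next
  case False
  then have ne: "pverts G - spread B \<noteq> {}" by blast
  from False have "\<not> pverts G \<subseteq> B" using subset_spread by blast
  then show ?thesis
    using False ne by (subst rounds_left.simps) simp
qed

end

section \<open>The cycle: cyclic segments and the ends of a vertex set\<close>

locale cycle =
  fixes n :: nat
  assumes n_ge_3: "n \<ge> 3"

sublocale cycle \<subseteq> pair_graph "cycle_graph n"
  by (rule pair_graph_cycle_graph[OF n_ge_3])

context cycle
begin

abbreviation V :: "nat set" where "V \<equiv> {..<n}"

abbreviation next_vertex :: "nat \<Rightarrow> nat" where "next_vertex i \<equiv> Suc i mod n"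

text \<open>Start and length may both exceed \<open>n\<close>, so a segment that has grown around
  the whole cycle needs no special treatment.\<close>

definition segment :: "nat \<Rightarrow> nat \<Rightarrow> nat set" where
  "segment a l = (\<lambda>j. (a + j) mod n) ` {..<l}"

definition right_ends :: "nat set \<Rightarrow> nat set" where
  "right_ends B = {i \<in> B. next_vertex i \<notin> B}"

text \<open>A left end is represented by the outside vertex in front of it, so that
  \<open>next_vertex\<close> suffices and no predecessor function has to be introduced.\<close>

definition before_left_ends :: "nat set \<Rightarrow> nat set" where
  "before_left_ends B = {i \<in> V. i \<notin> B \<and> next_vertex i \<in> B}"

lemma n_pos: "n > 0" and next_vertex_less [simp]: "next_vertex i < n"
  using n_ge_3 by auto

lemma verts_cycle [simp]: "pverts (cycle_graph n) = V"
  by (simp add: cycle_graph_def)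

lemma inj_on_next_vertex: "inj_on next_vertex V"
  by (auto simp: inj_on_def mod_Suc split: if_splits)

lemma finite_right_ends: "B \<subseteq> V \<Longrightarrow> finite (right_ends B)"
  by (rule finite_subset[of _ V]) (auto simp: right_ends_def)

lemma finite_before_left_ends: "finite (before_left_ends B)"
  by (simp add: before_left_ends_def)

lemma spread_cycle:
  "B \<subseteq> V \<Longrightarrow> spread B = B \<union> next_vertex ` B \<union> {v \<in> V. next_vertex v \<in> B}"
  unfolding spread_def by (auto simp: cycle_graph_def)

lemma segment_memI: "j < l \<Longrightarrow> (a + j) mod n \<in> segment a l"
  by (auto simp: segment_def)

lemma segment_subset: "segment a l \<subseteq> V"
  using n_pos by (auto simp: segment_def)

lemma inj_on_add_mod: "inj_on (\<lambda>j. (a + j) mod n) {..<n}"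
proof (rule inj_onI)
  fix i j assume ij: "i \<in> {..<n}" "j \<in> {..<n}" "(a + i) mod n = (a + j) mod n"
  then have "[a + i = a + j] (mod n)" by (simp add: cong_def)
  then have "[i = j] (mod n)" by (simp only: cong_add_lcancel_nat)
  then show "i = j" using ij by (simp add: cong_def)
qed

lemma card_segment: "l \<le> n \<Longrightarrow> card (segment a l) = l"
  using inj_on_subset[OF inj_on_add_mod, of "{..<l}" a] by (simp add: segment_def card_image)

lemma segment_eq_V: "n \<le> l \<Longrightarrow> segment a l = V"
proof -
  assume l: "n \<le> l"
  have "segment a n = V"
    by (rule card_subset_eq) (use segment_subset card_segment in auto)
  moreover have "segment a n \<subseteq> segment a l" using l by (auto simp: segment_def)
  ultimately show ?thesis using segment_subset by blast
qed

text \<open>Growth by one vertex on each side; adding \<open>n - 1\<close> to the start is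
  subtraction of 1 modulo \<open>n\<close> within the natural numbers.\<close>

lemma spread_segment:
  assumes "l > 0"
  shows "spread (segment a l) = segment (a + (n - 1)) (l + 2)"
proof
  have n1: "n - 1 + 1 = n" using n_pos by simp
  show "spread (segment a l) \<subseteq> segment (a + (n - 1)) (l + 2)"
  proof
    fix x assume "x \<in> spread (segment a l)"
    then consider "x \<in> segment a l" | y where "y \<in> segment a l" "x = next_vertex y"
      | "x \<in> V" "next_vertex x \<in> segment a l"
      using spread_cycle[OF segment_subset] by blast
    then show "x \<in> segment (a + (n - 1)) (l + 2)"
    proof cases
      case 1
      then obtain j where "j < l" "x = (a + j) mod n" by (auto simp: segment_def)
      moreover have "a + (n - 1) + Suc j = a + j + n" using n_pos by simp
      ultimately have "x = (a + (n - 1) + Suc j) mod n" "Suc j < l + 2" by (simp_all only: mod_add_self2)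
      then show ?thesis using segment_memI by blast
    next
      case 2
      then obtain j where "j < l" "y = (a + j) mod n" by (auto simp: segment_def)
      then have "x = Suc (a + j) mod n" "j + 2 < l + 2" using 2 by (simp_all add: mod_Suc_eq)
      moreover have "a + (n - 1) + (j + 2) = Suc (a + j) + n" using n_pos by simp
      ultimately have "x = (a + (n - 1) + (j + 2)) mod n" "j + 2 < l + 2"
        by (simp_all only: mod_add_self2)
      then show ?thesis using segment_memI by blast
    next
      case 3
      then obtain j where j: "j < l" "next_vertex x = (a + j) mod n" by (auto simp: segment_def)
      have "Suc (a + (n - 1) + j) = a + j + n" using n_pos by simp
      then have "next_vertex ((a + (n - 1) + j) mod n) = (a + j) mod n"
        by (simp only: mod_Suc_eq mod_add_self2)
      then have "next_vertex x = next_vertex ((a + (n - 1) + j) mod n)" using j by simp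
      then have "x = (a + (n - 1) + j) mod n"
        using 3 n_pos inj_on_next_vertex by (auto dest: inj_onD)
      moreover have "j < l + 2" using j(1) by simp
      ultimately show ?thesis using segment_memI by blast
    qed
  qed
  show "segment (a + (n - 1)) (l + 2) \<subseteq> spread (segment a l)"
  proof
    fix x assume "x \<in> segment (a + (n - 1)) (l + 2)"
    then obtain j where j: "j < l + 2" "x = (a + (n - 1) + j) mod n" by (auto simp: segment_def)
    consider "j = 0" | i where "j = Suc i" "i < l" | "j = l + 1"
      using j(1) by (cases j) (auto simp: less_Suc_eq)
    then show "x \<in> spread (segment a l)"
    proof cases
      case 1
      then have "next_vertex x = Suc (a + (n - 1)) mod n" using j by (simp add: mod_Suc_eq)
      moreover have "Suc (a + (n - 1)) = a + 0 + n" using n_pos by simp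
      ultimately have "next_vertex x = (a + 0) mod n" by (simp only: mod_add_self2)
      then have "next_vertex x \<in> segment a l" using segment_memI[OF assms, of a] by simp
      moreover have "x \<in> V" using j n_pos by simp
      ultimately show ?thesis using spread_cycle[OF segment_subset] by blast
    next
      case (2 i)
      have "a + (n - 1) + Suc i = a + i + n" using n_pos by simp
      then have "x = (a + i) mod n" using j 2 by (simp only: mod_add_self2)
      then have "x \<in> segment a l" using 2 by (auto simp: segment_def)
      then show ?thesis using subset_spread by blast
    next
      case 3
      have "a + (n - 1) + (l + 1) = a + l + n" using n_pos by simp
      then have "x = (a + l) mod n" using j 3 by (simp only: mod_add_self2)
      then have "x = next_vertex ((a + (l - 1)) mod n)"
        using assms by (simp add: mod_Suc_eq)
      moreover have "(a + (l - 1)) mod n \<in> segment a l" by (rule segment_memI) (use assms in simp)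
      ultimately show ?thesis using spread_cycle[OF segment_subset] by blast
    qed
  qed
qed

lemma funpow_spread_singleton:
  assumes "v < n"
  shows "(spread ^^ k) {v} = segment (v + k * (n - 1)) (2 * k + 1)"
proof (induction k)
  case 0
  show ?case using assms by (auto simp: segment_def)
next
  case (Suc k)
  have "v + Suc k * (n - 1) = v + k * (n - 1) + (n - 1)" by simp
  moreover have "2 * Suc k + 1 = 2 * k + 1 + 2" by simp
  ultimately show ?case using Suc by (simp only: funpow.simps o_apply) (simp only: spread_segment)
qed

text \<open>Repeated steps from one vertex of \<open>B\<close> run through a segment of length
  \<open>n\<close>, which is the whole cycle.\<close>

lemma next_vertex_closed:
  assumes "B \<subseteq> V" "B \<noteq> {}" "\<And>i. i \<in> B \<Longrightarrow> next_vertex i \<in> B"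
  shows "B = V"
proof -
  obtain b where b: "b \<in> B" using assms by blast
  have "(b + j) mod n \<in> B" for j
  proof (induction j)
    case 0 then show ?case using b assms(1) by auto
  next
    case (Suc j)
    then show ?case using assms(3)[OF Suc] by (simp add: mod_Suc_eq)
  qed
  then have "segment b n \<subseteq> B" by (auto simp: segment_def)
  then show ?thesis using segment_eq_V[of n b] assms(1) by auto
qed

lemma right_ends_nonempty:
  assumes "B \<subseteq> V" "B \<noteq> {}" "B \<noteq> V"
  shows "right_ends B \<noteq> {}"
  using next_vertex_closed[OF assms(1,2)] assms(3) by (auto simp: right_ends_def)

lemma right_ends_empty_imp: "right_ends B = {} \<Longrightarrow> B \<subseteq> V \<Longrightarrow> B \<noteq> {} \<Longrightarrow> B = V"
  using right_ends_nonempty by blast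

lemma right_ends_V: "right_ends V = {}"
  using n_pos by (auto simp: right_ends_def)

subsection \<open>Lower bounds\<close>

lemma card_spread_le:
  assumes "B \<subseteq> V" "card (right_ends B) \<le> c" "card (before_left_ends B) \<le> c"
  shows "card (spread B) \<le> card B + 2 * c"
proof -
  have fin: "finite B" using assms(1) finite_subset by blast
  have "spread B \<subseteq> B \<union> (next_vertex ` right_ends B \<union> before_left_ends B)"
    using assms(1) by (auto simp: spread_cycle right_ends_def before_left_ends_def)
  then have "card (spread B) \<le> card (B \<union> (next_vertex ` right_ends B \<union> before_left_ends B))"
    by (rule card_mono[rotated])
      (use fin finite_right_ends[OF assms(1)] finite_before_left_ends in auto)
  also have "\<dots> \<le> card B + (card (next_vertex ` right_ends B) + card (before_left_ends B))"
    by (meson add_left_mono card_Un_le le_trans)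
  also have "card (next_vertex ` right_ends B) \<le> card (right_ends B)"
    by (rule card_image_le) (use finite_right_ends[OF assms(1)] in auto)
  finally show ?thesis using assms by linarith
qed

text \<open>A right end after spreading must be the successor of an old one; segments may merge but
  never split.\<close>

lemma card_right_ends_spread_le:
  assumes "B \<subseteq> V"
  shows "card (right_ends (spread B)) \<le> card (right_ends B)"
proof -
  have "right_ends (spread B) \<subseteq> next_vertex ` right_ends B"
    using assms by (auto simp: spread_cycle right_ends_def)
  then show ?thesis
    using finite_right_ends[OF assms] surj_card_le by blast
qed

text \<open>Mirror image of the previous lemma. The injection goes from the new ends to the old
  ones, because \<open>next_vertex\<close> undoes the growth to the left.\<close>

lemma card_before_left_ends_spread_le:
  assumes "B \<subseteq> V"
  shows "card (before_left_ends (spread B)) \<le> card (before_left_ends B)"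
proof (rule card_inj_on_le)
  show "inj_on next_vertex (before_left_ends (spread B))"
    by (rule inj_on_subset[OF inj_on_next_vertex]) (auto simp: before_left_ends_def)
  show "next_vertex ` before_left_ends (spread B) \<subseteq> before_left_ends B"
  proof
    fix y assume "y \<in> next_vertex ` before_left_ends (spread B)"
    then obtain x where x: "x \<in> V" "x \<notin> spread B" "next_vertex x \<in> spread B" "y = next_vertex x"
      by (auto simp: before_left_ends_def)
    note sp = spread_cycle[OF assms]
    have "y \<notin> B" using x sp by blast
    moreover have "y \<notin> next_vertex ` B"
    proof
      assume "y \<in> next_vertex ` B"
      then obtain b where b: "b \<in> B" "next_vertex x = next_vertex b" unfolding x(4) by (rule imageE)
      have "b \<in> V" using assms b(1) by blast
      then have "x = b" by (rule inj_onD[OF inj_on_next_vertex b(2) x(1)])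
      then show False using b(1) x(2) sp by blast
    qed
    ultimately show "y \<in> before_left_ends B"
      using x(3,4) sp by (auto simp: before_left_ends_def)
  qed
qed (rule finite_before_left_ends)

lemma card_right_ends_insert_le: "B \<subseteq> V \<Longrightarrow> card (right_ends (insert v B)) \<le> Suc (card (right_ends B))"
proof -
  assume B: "B \<subseteq> V"
  have "right_ends (insert v B) \<subseteq> insert v (right_ends B)" by (auto simp: right_ends_def)
  then have "card (right_ends (insert v B)) \<le> card (insert v (right_ends B))"
    using finite_right_ends[OF B] by (intro card_mono) auto
  also have "\<dots> \<le> Suc (card (right_ends B))"
    by (simp add: card_insert_le_m1 finite_right_ends[OF B] card_insert_if)
  finally show ?thesis .
qed

lemma card_before_left_ends_insert_le:
  assumes "v \<in> V"
  shows "card (before_left_ends (insert v B)) \<le> Suc (card (before_left_ends B))"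
proof -
  \<comment> \<open>\<open>u\<close> is the predecessor of \<open>v\<close>, the only vertex that
    can enter the set.\<close>
  obtain u where u: "\<And>w. w \<in> V \<Longrightarrow> next_vertex w = v \<Longrightarrow> w = u"
    using inj_on_next_vertex unfolding inj_on_def by metis
  have "before_left_ends (insert v B) \<subseteq> insert u (before_left_ends B)"
    using u by (auto simp: before_left_ends_def)
  then have "card (before_left_ends (insert v B)) \<le> card (insert u (before_left_ends B))"
    using finite_before_left_ends by (intro card_mono) auto
  also have "\<dots> \<le> Suc (card (before_left_ends B))"
    by (simp add: finite_before_left_ends card_insert_if)
  finally show ?thesis .
qed

text \<open>Extending a segment only moves its right end: \<open>i\<close> ceases to be one and its
  successor may take over. This is the effect of Staller's strategy.\<close>

lemma card_right_ends_insert_next_le: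
  assumes "B \<subseteq> V" "i \<in> right_ends B"
  shows "card (right_ends (insert (next_vertex i) B)) \<le> card (right_ends B)"
proof -
  have "right_ends (insert (next_vertex i) B) \<subseteq> insert (next_vertex i) (right_ends B - {i})"
    by (auto simp: right_ends_def)
  then have "card (right_ends (insert (next_vertex i) B)) \<le> card (insert (next_vertex i) (right_ends B - {i}))"
    using finite_right_ends[OF assms(1)] by (intro card_mono) auto
  also have "\<dots> \<le> Suc (card (right_ends B - {i}))"
    by (simp add: finite_right_ends[OF assms(1)] card_insert_if)
  also have "\<dots> = card (right_ends B)"
    by (rule card_Suc_Diff1) (use finite_right_ends assms in auto)
  finally show ?thesis .
qed

lemma card_before_left_ends_insert_next_le:
  assumes "B \<subseteq> V" "i \<in> right_ends B"
  shows "card (before_left_ends (insert (next_vertex i) B)) \<le> card (before_left_ends B)"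
proof (rule card_mono)
  have i: "i \<in> B" using assms(2) by (simp add: right_ends_def)
  have eq: "w = i" if "w \<in> V" "next_vertex w = next_vertex i" for w
    using inj_onD[OF inj_on_next_vertex that(2)] that(1) assms(1) i by blast
  show "before_left_ends (insert (next_vertex i) B) \<subseteq> before_left_ends B"
    unfolding before_left_ends_def using eq i by blast
qed (rule finite_before_left_ends)

text \<open>Everything is doubled to avoid halves. Each of the \<open>k\<close> rounds spreads to at
  most \<open>2 * c\<close> vertices, which gives \<open>4 * c * k\<close>. The remaining terms
  count the selections and the extra spreading from the segments that Burner's later selections
  open, each raising \<open>c\<close> by one.\<close>

lemma rounds_left_lower_bound:
  assumes "B \<subseteq> V" "B \<noteq> {}" "card (right_ends B) \<le> c" "card (before_left_ends B) \<le> c"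
    "rounds_left p B \<le> k"
  shows "2 * n \<le> 2 * card B + 4 * c * k + k\<^sup>2 + (case p of Burner \<Rightarrow> 2 * k | Staller \<Rightarrow> 1)"
  using assms
proof (induction k arbitrary: p B c)
  case 0
  then have "V = B" by (auto simp: rounds_left_eq_0_iff)
  then have "card B = n" by auto
  then show ?case by simp
next
  case (Suc k)
  let ?S = "spread B"
  note bounds = card_spread_le[OF Suc.prems(1,3,4)] card_right_ends_spread_le[OF Suc.prems(1)]
    card_before_left_ends_spread_le[OF Suc.prems(1)]
  have S: "?S \<subseteq> V" "?S \<noteq> {}"
    using spread_subset_verts[of B] subset_spread[of B] Suc.prems by auto
  show ?case
  proof (cases "V \<subseteq> ?S")
    case True
    then have "card ?S = n" using S by (metis card_lessThan subset_antisym)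
    then have "2 * n \<le> 2 * card B + 4 * c" using bounds by linarith
    also have "\<dots> \<le> 2 * card B + 4 * c * Suc k" by simp
    finally show ?thesis by linarith
  next
    case False
    have card: "card (insert v ?S) \<le> card B + 2 * c + 1" for v
      using bounds(1) S finite_subset[OF S(1)] by (simp add: card_insert_if)
    show ?thesis
    proof (cases p)
      case Burner
      then obtain v where v: "v \<in> V" "rounds_left Staller (insert v ?S) \<le> k"
        using Suc.prems(5) False by (auto simp: rounds_left_Burner_le_Suc_iff)
      have "card (right_ends (insert v ?S)) \<le> Suc c" "card (before_left_ends (insert v ?S)) \<le> Suc c"
        using card_right_ends_insert_le[OF S(1), of v]
          card_before_left_ends_insert_le[OF v(1), of ?S] bounds Suc.prems by linarith+
      from Suc.IH[OF _ _ this v(2)] have "2 * n \<le> 2 * card (insert v ?S) + 4 * Suc c * k + k\<^sup>2 + 1"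
        using v S by auto
      also have "\<dots> \<le> 2 * (card B + 2 * c + 1) + 4 * Suc c * k + k\<^sup>2 + 1" using card[of v] by simp
      also have "\<dots> = 2 * card B + 4 * c * Suc k + (Suc k)\<^sup>2 + 2 * Suc k"
        by (simp add: power2_eq_square algebra_simps)
      finally show ?thesis using Burner by simp
    next
      case Staller
      \<comment> \<open>Staller selects the successor of a right end of the spread set, which keeps
        both end counts at most \<open>c\<close>.\<close>
      obtain i where i: "i \<in> right_ends ?S" using right_ends_nonempty[OF S] False by auto
      define v where "v = next_vertex i"
      have v: "v \<in> V - ?S" using i by (simp add: v_def right_ends_def)
      then have r: "rounds_left Burner (insert v ?S) \<le> k"
        using Staller Suc.prems(5) by (auto simp: rounds_left_Staller_le_Suc_iff)
      have "card (right_ends (insert v ?S)) \<le> c" "card (before_left_ends (insert v ?S)) \<le> c"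
        using card_right_ends_insert_next_le[OF S(1) i]
          card_before_left_ends_insert_next_le[OF S(1) i] bounds Suc.prems
        unfolding v_def by linarith+
      from Suc.IH[OF _ _ this r] have "2 * n \<le> 2 * card (insert v ?S) + 4 * c * k + k\<^sup>2 + 2 * k"
        using v S by auto
      also have "\<dots> \<le> 2 * (card B + 2 * c + 1) + 4 * c * k + k\<^sup>2 + 2 * k" using card[of v] by simp
      also have "\<dots> = 2 * card B + 4 * c * Suc k + (Suc k)\<^sup>2 + 1"
        by (simp add: power2_eq_square algebra_simps)
      finally show ?thesis using Staller by simp
    qed
  qed
qed

lemma rounds_left_singleton_lower_bound:
  assumes "v \<in> V" "rounds_left p {v} \<le> k"
  shows "2 * n \<le> 2 + 4 * k + k\<^sup>2 + (case p of Burner \<Rightarrow> 2 * k | Staller \<Rightarrow> 1)"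
proof -
  \<comment> \<open>A single vertex is an insertion into the empty set, so \<open>c = 1\<close> is
    admissible.\<close>
  have "right_ends {} = {}" "before_left_ends {} = {}"
    by (auto simp: right_ends_def before_left_ends_def)
  then have "card (right_ends {v}) \<le> 1" "card (before_left_ends {v}) \<le> 1"
    using card_right_ends_insert_le[of "{}" v] card_before_left_ends_insert_le[OF assms(1), of "{}"]
    by auto
  from rounds_left_lower_bound[OF _ _ this assms(2)] assms(1) show ?thesis by simp
qed

subsection \<open>Upper bounds\<close>

text \<open>Walking along the segment from a vertex of \<open>C\<close> to its last vertex, which is
  outside \<open>C\<close>, one has to leave \<open>C\<close> at some step.\<close>

lemma segment_right_end_obtain:
  assumes "x \<in> segment a l \<inter> C" "(a + (l - 1)) mod n \<notin> C"
  obtains j where "Suc j < l" "(a + j) mod n \<in> C" "(a + Suc j) mod n \<notin> C"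
proof -
  obtain i where i: "i < l" "(a + i) mod n \<in> C" using assms(1) unfolding segment_def by blast
  have "\<exists>j. Suc j < l \<and> (a + j) mod n \<in> C \<and> (a + Suc j) mod n \<notin> C"
  proof (rule ccontr)
    assume *: "\<not> ?thesis"
    have "i + d < l \<Longrightarrow> (a + (i + d)) mod n \<in> C" for d
    proof (induction d)
      case 0
      then show ?case using i(2) by simp
    next
      case (Suc d)
      then have "(a + (i + d)) mod n \<in> C" "Suc (i + d) < l" by simp_all
      then show ?case using * by (metis add_Suc_right)
    qed
    from this[of "l - 1 - i"] show False using i(1) assms(2) by simp
  qed
  then show ?thesis using that by blast
qed

lemma right_ends_Un_segment_subset:
  assumes "l > 0"
  shows "right_ends (C \<union> segment a l) \<subseteq> insert ((a + (l - 1)) mod n) (right_ends C)"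
proof
  fix x assume x: "x \<in> right_ends (C \<union> segment a l)"
  show "x \<in> insert ((a + (l - 1)) mod n) (right_ends C)"
  proof (cases "x \<in> C")
    case True
    then show ?thesis using x by (auto simp: right_ends_def)
  next
    case False
    then obtain j where j: "j < l" "x = (a + j) mod n" using x unfolding right_ends_def segment_def by blast
    have "\<not> Suc j < l"
    proof
      assume "Suc j < l"
      then have "(a + Suc j) mod n \<in> segment a l" by (rule segment_memI)
      moreover have "next_vertex x = (a + Suc j) mod n" using j(2) by (simp add: mod_Suc_eq)
      ultimately show False using x by (simp add: right_ends_def)
    qed
    then have "j = l - 1" using j by simp
    then show ?thesis using j by simp
  qed
qed

text \<open>The union gains at most one right end, the last vertex of the segment, and loses those
  right ends of \<open>C\<close> whose successors are covered. Meeting \<open>C\<close> either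
  prevents the gain or forces a loss inside the segment; starting just behind \<open>i\<close>
  forces the loss of \<open>i\<close>.\<close>

lemma card_right_ends_Un_segment:
  assumes C: "C \<subseteq> V" and l: "0 < l" "l \<le> n"
  shows "card (right_ends (C \<union> segment a l)) \<le> card (right_ends C) + 1"
    and "C \<inter> segment a l \<noteq> {} \<Longrightarrow> card (right_ends (C \<union> segment a l)) \<le> card (right_ends C)"
    and "i \<in> right_ends C \<Longrightarrow> a mod n = next_vertex i \<Longrightarrow>
      card (right_ends (C \<union> segment a l)) \<le> card (right_ends C)"
    and "i \<in> right_ends C \<Longrightarrow> a mod n = next_vertex i \<Longrightarrow> C \<inter> segment a l \<noteq> {} \<Longrightarrow>
      card (right_ends (C \<union> segment a l)) < card (right_ends C)"
proof -
  let ?A = "segment a l" and ?e = "(a + (l - 1)) mod n" and ?R = "right_ends C"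
  have fin: "finite ?R" by (rule finite_right_ends[OF C])
  note sub = right_ends_Un_segment_subset[OF l(1), of C a]
  \<comment> \<open>\<open>X\<close> collects right ends of \<open>C\<close> that disappear;
    \<open>bound'\<close> below is the case in which the last vertex lies in \<open>C\<close> and
    nothing is gained.\<close>
  have bound: "card (right_ends (C \<union> ?A)) + card X \<le> card ?R + 1"
    if "X \<subseteq> ?R" "X \<inter> right_ends (C \<union> ?A) = {}" for X
  proof -
    have "card (right_ends (C \<union> ?A)) \<le> card (insert ?e (?R - X))"
      by (rule card_mono) (use sub that fin in auto)
    also have "\<dots> \<le> Suc (card (?R - X))" using fin by (simp add: card_insert_if)
    also have "card (?R - X) = card ?R - card X"
      using that fin by (simp add: card_Diff_subset finite_subset)
    finally show ?thesis using card_mono[OF fin that(1)] by linarith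
  qed
  have bound': "card (right_ends (C \<union> ?A)) + card X \<le> card ?R"
    if "X \<subseteq> ?R" "X \<inter> right_ends (C \<union> ?A) = {}" "?e \<in> C" for X
  proof -
    have "right_ends (C \<union> ?A) \<subseteq> ?R - X"
      using sub that by (auto simp: right_ends_def)
    then have "card (right_ends (C \<union> ?A)) \<le> card (?R - X)"
      using fin by (intro card_mono) auto
    also have "card (?R - X) = card ?R - card X"
      using that fin by (simp add: card_Diff_subset finite_subset)
    finally show ?thesis using card_mono[OF fin that(1)] by linarith
  qed
  show "card (right_ends (C \<union> ?A)) \<le> card ?R + 1" using bound[of "{}"] by simp
  have last: "\<exists>j. Suc j < l \<and> (a + j) mod n \<in> ?R \<and> (a + j) mod n \<notin> right_ends (C \<union> ?A)"
    if "C \<inter> ?A \<noteq> {}" "?e \<notin> C"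
  proof -
    obtain x where "x \<in> ?A \<inter> C" using \<open>C \<inter> ?A \<noteq> {}\<close> by blast
    then obtain j where j: "Suc j < l" "(a + j) mod n \<in> C" "(a + Suc j) mod n \<notin> C"
      using \<open>?e \<notin> C\<close> by (rule segment_right_end_obtain)
    have "next_vertex ((a + j) mod n) = (a + Suc j) mod n" by (simp add: mod_Suc_eq)
    then have "(a + j) mod n \<in> ?R" "(a + j) mod n \<notin> right_ends (C \<union> ?A)"
      using j(2,3) segment_memI[OF j(1), of a] by (simp_all add: right_ends_def)
    then show ?thesis using j(1) by blast
  qed
  show "card (right_ends (C \<union> ?A)) \<le> card ?R" if "C \<inter> ?A \<noteq> {}"
  proof (cases "?e \<in> C")
    case True
    then show ?thesis using bound'[of "{}"] by simp
  next
    case False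
    from last[OF that this] obtain j where
      "(a + j) mod n \<in> ?R" "(a + j) mod n \<notin> right_ends (C \<union> ?A)" by blast
    then show ?thesis using bound[of "{(a + j) mod n}"] by simp
  qed
  assume i: "i \<in> ?R" "a mod n = next_vertex i"
  have "(a + 0) mod n \<in> ?A" using segment_memI[OF l(1)] .
  then have i': "i \<notin> right_ends (C \<union> ?A)" using i by (simp add: right_ends_def)
  show "card (right_ends (C \<union> ?A)) \<le> card ?R" using bound[of "{i}"] i i' by simp
  assume ne: "C \<inter> ?A \<noteq> {}"
  show "card (right_ends (C \<union> ?A)) < card ?R"
  proof (cases "?e \<in> C")
    case True
    then show ?thesis using bound'[of "{i}"] i i' by simp
  next
    case False
    from last[OF ne this] obtain j where j: "Suc j < l"
      "(a + j) mod n \<in> ?R" "(a + j) mod n \<notin> right_ends (C \<union> ?A)" by blast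
    \<comment> \<open>Two different ends are lost: if they coincided, the segment would return to
      its start after \<open>Suc j < l\<close> steps, with \<open>l \<le> n\<close>.\<close>
    have "i \<noteq> (a + j) mod n"
    proof
      assume "i = (a + j) mod n"
      then have "(a + Suc j) mod n = (a + 0) mod n" using i by (simp add: mod_Suc_eq)
      then have "Suc j = 0" by (rule inj_onD[OF inj_on_add_mod]) (use j(1) l in auto)
      then show False by simp
    qed
    then show ?thesis using bound[of "{i, (a + j) mod n}"] i i' j by simp
  qed
qed

text \<open>Unless \<open>C\<close> is empty or full, its right ends are in bijection with its gaps. If \<open>C\<close> is full,
  the subtraction is truncated and the deficit is \<open>0\<close>.\<close>

definition deficit :: "nat \<Rightarrow> nat set \<Rightarrow> nat" where
  "deficit r C = 2 * card (V - C) + 4 * r * (card (right_ends C) - 1)"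

lemma deficit_V [simp]: "deficit r V = 0"
  by (simp add: deficit_def right_ends_V)

lemma card_Diff_Un_segment_disjoint:
  assumes "C \<inter> segment a l = {}" "l \<le> n"
  shows "card (V - (C \<union> segment a l)) + l = card (V - C)"
proof -
  have "V - C = (V - (C \<union> segment a l)) \<union> segment a l"
    using assms segment_subset by blast
  then have "card (V - C) = card (V - (C \<union> segment a l)) + card (segment a l)"
    using segment_subset finite_subset[OF segment_subset] by (subst card_Un_disjoint[symmetric]) auto
  then show ?thesis using card_segment assms by simp
qed

text \<open>Staller's move, at an arbitrary place. A segment meeting \<open>C\<close> adds no gap. A
  disjoint one may add a gap, at a cost of at most \<open>4 * r\<close>, but covers
  \<open>2 * r + 1\<close> new vertices, which saves \<open>4 * r + 2\<close>.\<close>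

lemma deficit_Un_segment_le:
  assumes C: "C \<subseteq> V" "C \<noteq> {}"
  shows "deficit (r - 1) (C \<union> segment a (2 * r + 1)) \<le> deficit r C"
proof (cases "2 * r + 1 \<le> n")
  case False
  then show ?thesis using C segment_eq_V[of "2*r+1" a] by (simp add: Un_absorb1)
next
  case True
  let ?A = "segment a (2 * r + 1)"
  note R = card_right_ends_Un_segment(1,2)[OF C(1) _ True, of a]
  show ?thesis
  proof (cases "C \<inter> ?A = {}")
    case False
    then have "card (right_ends (C \<union> ?A)) \<le> card (right_ends C)" using R(2) by simp
    moreover have "card (V - (C \<union> ?A)) \<le> card (V - C)" by (rule card_mono) auto
    ultimately show ?thesis unfolding deficit_def by (intro add_mono mult_mono) auto
  next
    case disj: True
    have *: "card (V - (C \<union> ?A)) + (2 * r + 1) = card (V - C)"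
      by (rule card_Diff_Un_segment_disjoint[OF disj True])
    \<comment> \<open>Hence \<open>C\<close> has a right end, and the truncated subtraction in its
      deficit is exact.\<close>
    then have "C \<noteq> V" by auto
    then have "card (right_ends C) \<ge> 1"
      using right_ends_nonempty[OF C] finite_right_ends[OF C(1)] by (simp add: Suc_le_eq card_gt_0_iff)
    then obtain m where m: "card (right_ends C) = Suc m" by (cases "card (right_ends C)") auto
    have "4 * (r - 1) * (card (right_ends (C \<union> ?A)) - 1) \<le> 4 * r * Suc m"
      using R(1) m by (intro mult_mono) auto
    then show ?thesis using * m unfolding deficit_def by (simp add: algebra_simps)
  qed
qed

text \<open>Burner's move. A disjoint segment saves \<open>4 * r + 2\<close> through its vertices
  without adding a gap. Otherwise a gap closes, which saves \<open>4 * r\<close>, or the cycle is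
  covered and the deficit is 0.\<close>

lemma deficit_Un_segment_next:
  assumes C: "C \<subseteq> V" and i: "i \<in> right_ends C" "a mod n = next_vertex i"
  shows "deficit (r - 1) (C \<union> segment a (2 * r + 1)) \<le> deficit r C - (4 * r + 2)"
proof (cases "2 * r + 1 \<le> n")
  case False
  then show ?thesis using C segment_eq_V[of "2*r+1" a] by (simp add: Un_absorb1)
next
  case True
  let ?A = "segment a (2 * r + 1)"
  let ?C = "C \<union> ?A"
  note R = card_right_ends_Un_segment(3,4)[OF C _ True i]
  show ?thesis
  proof (cases "C \<inter> ?A = {}")
    case disj: True
    have "card (V - ?C) + (2 * r + 1) = card (V - C)"
      by (rule card_Diff_Un_segment_disjoint[OF disj True])
    moreover have "4 * (r - 1) * (card (right_ends ?C) - 1) \<le> 4 * r * (card (right_ends C) - 1)"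
      using R(1) by (intro mult_mono) auto
    ultimately show ?thesis unfolding deficit_def by linarith
  next
    case False
    then have lt: "card (right_ends ?C) < card (right_ends C)" using R(2) by simp
    have C': "?C \<subseteq> V" "?C \<noteq> {}" using C segment_subset i by (auto simp: right_ends_def)
    show ?thesis
    proof (cases "right_ends ?C = {}")
      case True
      then show ?thesis using right_ends_empty_imp[OF _ C'] by simp
    next
      case ne: False
      have "card (right_ends ?C) \<noteq> 0"
        using finite_right_ends[OF C'(1)] ne by simp
      then obtain m where m: "card (right_ends ?C) = Suc m" by (cases "card (right_ends ?C)") auto
      \<comment> \<open>The successor of \<open>i\<close> is newly covered; this one vertex supplies
        the missing 2.\<close>
      have "(a + 0) mod n \<in> ?A" by (rule segment_memI) simp
      then have "next_vertex i \<in> V - C" "next_vertex i \<notin> V - ?C" using i by (auto simp: right_ends_def)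
      then have "V - ?C \<subset> V - C" by blast
      then have S: "card (V - ?C) < card (V - C)" by (intro psubset_card_mono) auto
      have "4 * (r - 1) * m \<le> 4 * r * m" by simp
      moreover have "4 * r * Suc m \<le> 4 * r * (card (right_ends C) - 1)"
        using lt m by (intro mult_mono) auto
      moreover have "4 * r * Suc m = 4 * r * m + 4 * r" by simp
      ultimately show ?thesis using S unfolding deficit_def m diff_Suc_1 by linarith
    qed
  qed
qed

text \<open>The next selection is followed by \<open>k - 1\<close> rounds, hence the index of the
  deficit. The budgets are the sums of the reductions \<open>4 * r + 2\<close> over Burner's
  remaining moves.\<close>

lemma rounds_left_upper_bound:
  assumes "B \<subseteq> V" "B \<noteq> {}"
    "deficit (k - 1) ((spread ^^ k) B) \<le> (case p of Burner \<Rightarrow> k * (k + 1) | Staller \<Rightarrow> k * (k - 1))"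
  shows "rounds_left p B \<le> k"
  using assms
proof (induction k arbitrary: p B)
  case 0
  then have "card (V - B) = 0" by (cases p) (auto simp: deficit_def)
  then show ?case by (auto simp: rounds_left_eq_0_iff)
next
  case (Suc k)
  define C where "C = (spread ^^ Suc k) B"
  have C: "C \<subseteq> V" "C \<noteq> {}"
    using funpow_spread_subset_verts[of B "Suc k"] subset_funpow_spread[of B "Suc k"] Suc.prems
    unfolding C_def by auto
  have S: "spread B \<subseteq> V" using spread_subset_verts[of B] Suc.prems by simp
  \<comment> \<open>Spreading distributes over unions, so the selected vertex contributes a segment
    centred at it, independently of \<open>C\<close>.\<close>
  have ins: "(spread ^^ k) (insert v (spread B)) = C \<union> segment (v + k * (n - 1)) (2 * k + 1)"
    if "v \<in> V" for v
    using that funpow_spread_Un[of k "{v}" "spread B"] funpow_spread_singleton[of v k]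
    by (simp add: C_def funpow_swap1 Un_commute)
  show ?case
  proof (cases p)
    case Staller
    have "rounds_left Burner (insert v (spread B)) \<le> k" if v: "v \<in> V - spread B" for v
    proof (rule Suc.IH)
      have "deficit (k - 1) ((spread ^^ k) (insert v (spread B))) \<le> deficit k C"
        unfolding ins[OF DiffD1[OF v]] by (rule deficit_Un_segment_le[OF C])
      also have "\<dots> \<le> k * (k + 1)" using Suc.prems(3) Staller by (simp add: C_def)
      finally show "deficit (k - 1) ((spread ^^ k) (insert v (spread B)))
        \<le> (case Burner of Burner \<Rightarrow> k * (k + 1) | Staller \<Rightarrow> k * (k - 1))" by simp
    qed (use v S in auto)
    then show ?thesis using Staller by (simp add: rounds_left_Staller_le_Suc_iff)
  next
    case Burner
    have d: "deficit k C \<le> Suc k * (k + 2)" using Suc.prems(3) Burner by (simp add: C_def)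
    have "\<exists>v\<in>V - spread B. rounds_left Staller (insert v (spread B)) \<le> k" if ne: "\<not> V \<subseteq> spread B"
    proof (cases "C = V")
      \<comment> \<open>The vertices burned so far already suffice, so any legal selection will
        do.\<close>
      case True
      obtain v where v: "v \<in> V - spread B" using ne by blast
      have "rounds_left Staller (insert v (spread B)) \<le> k"
        by (rule Suc.IH) (use v S True ins[of v] segment_subset in \<open>auto simp: Un_absorb2\<close>)
      then show ?thesis using v by blast
    next
      case False
      obtain i where i: "i \<in> right_ends C" using right_ends_nonempty[OF C False] by blast
      \<comment> \<open>The centre of the segment of \<open>2 * k + 1\<close> vertices that starts
        at \<open>next_vertex i\<close>.\<close>
      define v where "v = (i + 1 + k) mod n"
      have "(v + k * (n - 1)) mod n = (i + 1 + k + k * (n - 1)) mod n"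
        by (simp add: v_def mod_add_left_eq)
      also have "k + k * (n - 1) = k * n" using n_pos by (cases n) auto
      then have "i + 1 + k + k * (n - 1) = Suc i + k * n" by simp
      finally have a: "(v + k * (n - 1)) mod n = next_vertex i" by simp
      have v: "v \<in> V" using n_pos by (simp add: v_def)
      \<comment> \<open>The selection is legal: otherwise it would change nothing, and
        \<open>next_vertex i\<close> would already lie in \<open>C\<close>.\<close>
      have "v \<notin> spread B"
      proof
        assume "v \<in> spread B"
        then have "(spread ^^ k) (insert v (spread B)) = C"
          by (simp add: insert_absorb C_def funpow_swap1)
        moreover have "(v + k * (n - 1) + 0) mod n \<in> segment (v + k * (n - 1)) (2 * k + 1)"
          by (rule segment_memI) simp
        ultimately have "next_vertex i \<in> C" using a ins[OF v] by auto
        then show False using i by (simp add: right_ends_def)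
      qed
      moreover have "rounds_left Staller (insert v (spread B)) \<le> k"
      proof (rule Suc.IH)
        have "deficit (k - 1) ((spread ^^ k) (insert v (spread B))) \<le> deficit k C - (4 * k + 2)"
          unfolding ins[OF v] by (rule deficit_Un_segment_next[OF C(1) i a])
        also have "\<dots> \<le> Suc k * (k + 2) - (4 * k + 2)" using d by simp
        \<comment> \<open>The budgets fit exactly: (k + 1)(k + 2) - (4k + 2) = k(k - 1).\<close>
        also have "\<dots> \<le> k * (k - 1)" by (cases k) (auto simp: algebra_simps)
        finally show "deficit (k - 1) ((spread ^^ k) (insert v (spread B)))
          \<le> (case Staller of Burner \<Rightarrow> k * (k + 1) | Staller \<Rightarrow> k * (k - 1))" by simp
      qed (use v S in auto)
      ultimately show ?thesis using v by blast
    qed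
    then show ?thesis using Burner by (auto simp: rounds_left_Burner_le_Suc_iff)
  qed
qed

lemma deficit_segment_le: "deficit r (segment a l) \<le> 2 * (n - l)" if "l > 0"
proof (cases "l \<le> n")
  case True
  have "card (right_ends ({} \<union> segment a l)) \<le> card (right_ends {}) + 1"
    by (rule card_right_ends_Un_segment(1)[OF _ that True]) simp
  then have "card (right_ends (segment a l)) \<le> 1" by (simp add: right_ends_def)
  moreover have "card (V - segment a l) = n - l"
    using card_Diff_subset[OF finite_subset[OF segment_subset] segment_subset] card_segment[OF True]
    by simp
  ultimately show ?thesis by (simp add: deficit_def)
qed (simp add: segment_eq_V)

text \<open>A single segment has at most one right end, so only its uncovered vertices count;
  \<open>4 * k + 2\<close> is twice its final length.\<close>

lemma rounds_left_singleton_upper_bound: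
  assumes "v \<in> V"
    "2 * n \<le> 4 * k + 2 + (case p of Burner \<Rightarrow> k * (k + 1) | Staller \<Rightarrow> k * (k - 1))"
  shows "rounds_left p {v} \<le> k"
proof (rule rounds_left_upper_bound)
  have "deficit (k - 1) ((spread ^^ k) {v}) \<le> 2 * (n - (2 * k + 1))"
    using assms(1) by (simp add: funpow_spread_singleton deficit_segment_le del: One_nat_def)
  also have "\<dots> \<le> (case p of Burner \<Rightarrow> k * (k + 1) | Staller \<Rightarrow> k * (k - 1))"
    using assms(2) by linarith
  finally show "deficit (k - 1) ((spread ^^ k) {v})
    \<le> (case p of Burner \<Rightarrow> k * (k + 1) | Staller \<Rightarrow> k * (k - 1))" .
qed (use assms in auto)

section \<open>The two game numbers, first as integer inequalities and then with ceilings\<close>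

lemma game_burning_number_bounds:
  shows "2 * n + 1 \<le> (game_burning_number + 1)\<^sup>2"
    and "0 < K \<Longrightarrow> 2 * n \<le> K\<^sup>2 + K \<Longrightarrow> game_burning_number \<le> K"
proof -
  have V: "V \<noteq> {}" "finite V" using n_pos by auto
  \<comment> \<open>One optimal start serves both directions, since the bounds for singletons hold
    at every vertex. Round 1 accounts for the shift from \<open>k\<close> to
    \<open>Suc k\<close>.\<close>
  have "(MIN v \<in> V. rounds_left Staller {v}) \<in> (\<lambda>v. rounds_left Staller {v}) ` V"
    using V by (intro Min_in) auto
  then obtain v where v: "v \<in> V" "(MIN v \<in> V. rounds_left Staller {v}) = rounds_left Staller {v}"
    by blast
  from rounds_left_singleton_lower_bound[OF v(1) order_refl, of Staller]
  show "2 * n + 1 \<le> (game_burning_number + 1)\<^sup>2"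
    using v by (simp add: game_burning_number_def power2_eq_square)
  assume K: "0 < K" "2 * n \<le> K\<^sup>2 + K"
  obtain k where k: "K = Suc k" using K by (cases K) auto
  have "2 * n \<le> 4 * k + 2 + k * (k - 1)"
    using K(2) k by (cases k) (auto simp: power2_eq_square)
  then have "rounds_left Staller {v} \<le> k" using rounds_left_singleton_upper_bound[OF v(1), of k Staller] by simp
  then show "game_burning_number \<le> K" using v k by (simp add: game_burning_number_def)
qed

lemma staller_game_burning_number_bounds:
  shows "2 * n + 7 \<le> (staller_game_burning_number + 2)\<^sup>2"
    and "0 < K \<Longrightarrow> 2 * n + 2 \<le> K\<^sup>2 + 3 * K \<Longrightarrow> staller_game_burning_number \<le> K"
proof -
  have V: "V \<noteq> {}" "finite V" using n_pos by auto
  have "(MAX v \<in> V. rounds_left Burner {v}) \<in> (\<lambda>v. rounds_left Burner {v}) ` V"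
    using V by (intro Max_in) auto
  then obtain v where v: "v \<in> V" "(MAX v \<in> V. rounds_left Burner {v}) = rounds_left Burner {v}"
    by blast
  from rounds_left_singleton_lower_bound[OF v(1) order_refl, of Burner]
  show "2 * n + 7 \<le> (staller_game_burning_number + 2)\<^sup>2"
    using v by (simp add: staller_game_burning_number_def power2_eq_square)
  assume K: "0 < K" "2 * n + 2 \<le> K\<^sup>2 + 3 * K"
  obtain k where k: "K = Suc k" using K by (cases K) auto
  have "2 * n \<le> 4 * k + 2 + k * (k + 1)"
    using K(2) k by (auto simp: power2_eq_square)
  then have "rounds_left Burner {v} \<le> k" using rounds_left_singleton_upper_bound[OF v(1), of k Burner] by simp
  then show "staller_game_burning_number \<le> K" using v k by (simp add: staller_game_burning_number_def)
qed

end

text \<open>The ceiling itself is used as \<open>K\<close>; \<open>d\<^sup>2 < x\<close> makes it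
  positive.\<close>

lemma le_ceiling_sqrt_diff:
  fixes b :: nat
  assumes bound: "\<And>K. 0 < K \<Longrightarrow> x \<le> (real K + d)\<^sup>2 \<Longrightarrow> b \<le> K"
    and "0 \<le> d" "d\<^sup>2 < x"
  shows "int b \<le> \<lceil>sqrt x - d\<rceil>"
proof -
  have "d < sqrt x" using assms by (simp add: real_less_rsqrt)
  then have pos: "0 < \<lceil>sqrt x - d\<rceil>" by simp
  define K where "K = nat \<lceil>sqrt x - d\<rceil>"
  have K: "int K = \<lceil>sqrt x - d\<rceil>" "0 < K" using pos by (auto simp: K_def)
  have "sqrt x - d \<le> real K" using K(1) by (metis le_of_int_ceiling of_int_of_nat_eq)
  then have "sqrt x \<le> real K + d" by simp
  then have "x \<le> (real K + d)\<^sup>2" by (rule sqrt_le_D)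
  then show ?thesis using bound[OF K(2)] K(1) by simp
qed

lemma ceiling_sqrt_diff_le:
  fixes b :: nat
  assumes "x \<le> (real b + d)\<^sup>2" "0 \<le> d"
  shows "\<lceil>sqrt x - d\<rceil> \<le> int b"
proof -
  have "sqrt x \<le> real b + d" using assms by (intro real_le_lsqrt) auto
  then show ?thesis by (simp add: ceiling_le_iff)
qed

theorem theorem4p4:
  fixes n :: nat
  assumes "n \<ge> 3"
  shows "\<lceil>sqrt (2 * real n + 1) - 1\<rceil> \<le> int (b\<^sub>g (cycle_graph n))
       \<and> int (b\<^sub>g (cycle_graph n)) \<le> \<lceil>sqrt (2 * real n + 1 / 4) - 1 / 2\<rceil>
       \<and> \<lceil>sqrt (2 * real n + 7) - 2\<rceil> \<le> int (b\<^sub>g' (cycle_graph n))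
       \<and> int (b\<^sub>g' (cycle_graph n)) \<le> \<lceil>sqrt (2 * real n + 17 / 4) - 3 / 2\<rceil>"
proof -
  interpret cycle n by unfold_locales (rule assms)
  have "2 * real n + 1 \<le> (real game_burning_number + 1)\<^sup>2"
    using of_nat_mono[OF game_burning_number_bounds(1), where ?'a = real] by (simp add: add.commute)
  \<comment> \<open>Completing the square: K^2 + K = (K + 1/2)^2 - 1/4.\<close>
  moreover have "game_burning_number \<le> K"
    if "0 < K" "2 * real n + 1 / 4 \<le> (real K + 1 / 2)\<^sup>2" for K
  proof -
    have "real (2 * n) \<le> real (K\<^sup>2 + K)"
      using that(2) by (simp add: power2_eq_square algebra_simps)
    then show ?thesis
      by (intro game_burning_number_bounds(2)[OF that(1)]) (simp only: of_nat_le_iff)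
  qed
  moreover have "2 * real n + 7 \<le> (real staller_game_burning_number + 2)\<^sup>2"
    using of_nat_mono[OF staller_game_burning_number_bounds(1), where ?'a = real] by (simp add: add.commute)
  \<comment> \<open>Here K^2 + 3K = (K + 3/2)^2 - 9/4, and 17/4 - 9/4 = 2.\<close>
  moreover have "staller_game_burning_number \<le> K"
    if "0 < K" "2 * real n + 17 / 4 \<le> (real K + 3 / 2)\<^sup>2" for K
  proof -
    have "real (2 * n + 2) \<le> real (K\<^sup>2 + 3 * K)"
      using that(2) by (simp add: power2_eq_square algebra_simps)
    then show ?thesis
      by (intro staller_game_burning_number_bounds(2)[OF that(1)]) (simp only: of_nat_le_iff)
  qed
  ultimately show ?thesis
    using assms by (intro conjI ceiling_sqrt_diff_le le_ceiling_sqrt_diff)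
      (auto simp: power2_eq_square)
qed

end
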